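(* Let $0\le\alpha<1$, let $\beta_1,\beta_2,\delta_1,\delta_2\ge 0$ and $\alpha_1,\alpha_2,\gamma_1,\gamma_2>0$ be real, and let $\sigma$ be a constant with $|\sigma|<1$. Let $f=h+\overline{g}\in SRH(\alpha)$. If $$W_{(\alpha_1,\beta_1),(\gamma_1,\delta_1)}(1)+|\sigma|\,W_{(\alpha_2,\beta_2),(\gamma_2,\delta_2)}(1)\le 2,$$ then $L(f)\in SRH(\alpha)$.
   Context: $D=\{z\in\mathbb C:|z|<1\}$. $\hat H$ is the class of complex-valued harmonic functions $f=h+\overline g$ on $D$ with $h,g$ analytic in $D$, $h(z)=z+\sum_{n=2}^\infty A_nz^n$, $g(z)=\sum_{n=1}^\infty B_nz^n$, $|B_1|<1$. For $0\le\alpha<1$, $HS^*(\alpha)$ (harmonic starlike functions of order $\alpha$) is the class of $f\in\hat H$ with $\frac{\partial}{\partial\theta}\arg f(re^{i\theta})>\alpha$ for all $0<r<1$, $0\le\theta\le2\pi$. $SRH(\alpha)$ is the subclass of $HS^*(\alpha)$ of functions $f=h+\overline g$ of the form $h(z)=z-\sum_{n=2}^\infty|A_n|z^n$, $g(z)=\sum_{n=1}^\infty|B_n|z^n$, $|B_1|<1$. Normalized four-parameter Wright function: for real $a,c>0$ and $b,d\ge0$, $$W_{(a,b),(c,d)}(z)=z+\sum_{n=2}^\infty\frac{\Gamma(a)\Gamma(c)}{\Gamma(a+(n-1)b)\,\Gamma(c+(n-1)d)}z^n .$$ $W(1)$ denotes the sum of this series at $z=1$; a hypothesis involving it is understood to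 include that it is finite (automatic if $b+d>0$). The operator $L$ (depending on $\alpha_i,\beta_i,\gamma_i,\delta_i$, $i=1,2$, and on $\sigma$ with $|\sigma|<1$) is $L(f)=H+\overline{\sigma G}$, where $H=h*W_{(\alpha_1,\beta_1),(\gamma_1,\delta_1)}$ and $G=g*W_{(\alpha_2,\beta_2),(\gamma_2,\delta_2)}$; here $*$ is the Hadamard product $\left(\sum a_nz^n\right)*\left(\sum b_nz^n\right)=\sum a_nb_nz^n$.
   Formalization: L(f) in SRH(α) is proved only for real σ ≥ 0; for other σ with |σ|<1 only L(f) in HS*(α) is proved, since the claim as printed fails there (α=0, σ=−1/2, f=z+z̄/4 gives z−z̄/8, not in SRH(0)). *)

theory Defs
  imports "HOL-Complex_Analysis.Complex_Analysis"
begin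

(* All functions are total on the complex plane; only their values on the unit disc
   "ball 0 1" are meaningful, and every notion below depends on those values only. *)

(* f = h + cnj g on the disc, with
   h(z) = z + (sum over n >= 2 of A n * z^n), g(z) = (sum over n >= 1 of B n * z^n)
   and |B 1| < 1.  The pair (h, g) is determined on the disc by f. *)
definition harmonic_decomp ::
  "(complex \<Rightarrow> complex) \<Rightarrow> (complex \<Rightarrow> complex) \<Rightarrow> (complex \<Rightarrow> complex) \<Rightarrow> bool" where
  "harmonic_decomp f h g \<longleftrightarrow>
     h holomorphic_on ball 0 1 \<and> g holomorphic_on ball 0 1 \<and>
     (\<forall>z\<in>ball 0 1. f z = h z + cnj (g z)) \<and>
     (\<exists>(A :: nat \<Rightarrow> complex) (B :: nat \<Rightarrow> complex). norm (B 1) < 1 \<and>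
        (\<forall>z\<in>ball 0 1. (\<lambda>n. A (n + 2) * z ^ (n + 2)) sums (h z - z) \<and>
                      (\<lambda>n. B (n + 1) * z ^ (n + 1)) sums g z))"

definition H_hat :: "(complex \<Rightarrow> complex) set" where
  "H_hat = {f. \<exists>h g. harmonic_decomp f h g}"

(* The condition (d/dtheta) arg f(r e^(i theta)) > alpha: f does not vanish at the point and
   some local branch phi of the argument of t |-> f (r e^(i t)) has derivative > alpha at theta.
   The derivative does not depend on the branch. *)
definition HS_star :: "real \<Rightarrow> (complex \<Rightarrow> complex) set" where
  "HS_star \<alpha> = {f \<in> H_hat. \<forall>(r :: real) (\<theta> :: real). 0 < r \<longrightarrow> r < 1 \<longrightarrow> 0 \<le> \<theta> \<longrightarrow> \<theta> \<le> 2 * pi \<longrightarrow>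
     f (rcis r \<theta>) \<noteq> 0 \<and>
     (\<exists>(\<phi> :: real \<Rightarrow> real) D.
        (\<forall>\<^sub>F t in nhds \<theta>. f (rcis r t) = rcis (norm (f (rcis r t))) (\<phi> t)) \<and>
        (\<phi> has_real_derivative D) (at \<theta>) \<and> \<alpha> < D)}"

definition SRH :: "real \<Rightarrow> (complex \<Rightarrow> complex) set" where
  "SRH \<alpha> = {f \<in> HS_star \<alpha>. \<exists>h g. harmonic_decomp f h g \<and>
     (\<exists>(A :: nat \<Rightarrow> complex) (B :: nat \<Rightarrow> complex). norm (B 1) < 1 \<and>
        (\<forall>z\<in>ball 0 1.
           (\<lambda>n. of_real (norm (A (n + 2))) * z ^ (n + 2)) sums (z - h z) \<and>
           (\<lambda>n. of_real (norm (B (n + 1))) * z ^ (n + 1)) sums g z))}"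

definition wright_coeff :: "real \<Rightarrow> real \<Rightarrow> real \<Rightarrow> real \<Rightarrow> nat \<Rightarrow> real" where
  "wright_coeff a b c d n =
     Gamma a * Gamma c / (Gamma (a + (real n - 1) * b) * Gamma (c + (real n - 1) * d))"

(* Polymorphic, so that both the function on the complex disc and the real number W(1) are
   instances.  At 1 the series may diverge (namely if b = d = 0): then the value is
   meaningless, so statements about W(1) need wright_finite as well. *)
definition wright ::
  "real \<Rightarrow> real \<Rightarrow> real \<Rightarrow> real \<Rightarrow> 'a :: {real_normed_field, banach} \<Rightarrow> 'a" where
  "wright a b c d z = z + (\<Sum>n. of_real (wright_coeff a b c d (n + 2)) * z ^ (n + 2))"

definition wright_finite :: "real \<Rightarrow> real \<Rightarrow> real \<Rightarrow> real \<Rightarrow> bool" where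
  "wright_finite a b c d \<longleftrightarrow> summable (\<lambda>n. wright_coeff a b c d (n + 2))"

definition hadamard ::
  "(complex \<Rightarrow> complex) \<Rightarrow> (complex \<Rightarrow> complex) \<Rightarrow> complex \<Rightarrow> complex" where
  "hadamard f g =
     eval_fps (Abs_fps (\<lambda>n. fps_nth (fps_expansion f 0) n * fps_nth (fps_expansion g 0) n))"

(* The operator applied to f = h + cnj g, given through its decomposition (h, g).

   Its co-analytic part is \<sigma> * G.  If \<sigma> is not a nonnegative real, the coefficients of \<sigma> * G
   are not of the form |B n| required in SRH (unless g = 0), even for f in SRH: with \<sigma> = -1/2
   the map z + cnj z / 4 of SRH 0 goes to z - cnj z / 8.  So membership of the image in SRH
   only makes sense for real \<sigma> >= 0, while membership in HS_star makes sense for every \<sigma>. *)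
definition wright_op ::
  "real \<Rightarrow> real \<Rightarrow> real \<Rightarrow> real \<Rightarrow> real \<Rightarrow> real \<Rightarrow> real \<Rightarrow> real \<Rightarrow> complex \<Rightarrow>
   (complex \<Rightarrow> complex) \<Rightarrow> (complex \<Rightarrow> complex) \<Rightarrow> complex \<Rightarrow> complex" where
  "wright_op \<alpha>1 \<beta>1 \<gamma>1 \<delta>1 \<alpha>2 \<beta>2 \<gamma>2 \<delta>2 \<sigma> h g = (\<lambda>z.
     hadamard h (wright \<alpha>1 \<beta>1 \<gamma>1 \<delta>1) z + cnj (\<sigma> * hadamard g (wright \<alpha>2 \<beta>2 \<gamma>2 \<delta>2) z))"

end

theory Submission
  imports Defs
begin

text \<open>
  The derivative of the argument of \<open>f = h + cnj g\<close> along a circle is \<open>Re (q / f)\<close> with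
  \<open>q z = z * h' z - cnj (z * g' z)\<close>.  If \<open>h z = z - (\<Sum>n\<ge>2. \<bar>a n\<bar> * z ^ n)\<close> and
  \<open>g z = (\<Sum>n\<ge>1. \<bar>b n\<bar> * z ^ n)\<close>, then \<open>f\<close> and \<open>q\<close> are real on the positive radius, and letting
  \<open>z\<close> tend to 1 along it shows that each of \<open>(n - \<alpha>) * \<bar>a n\<bar>\<close> and \<open>(n + \<alpha>) * \<bar>b n\<bar>\<close> is at most
  \<open>1 - \<alpha>\<close>.  The operator multiplies \<open>a n\<close> and \<open>b n\<close> by Wright coefficients (and \<open>\<sigma>\<close>), so the hypothesis
  on the values at 1 bounds the sum of all these weights of the image by \<open>1 - \<alpha>\<close>.  This is sufficient
  for starlikeness of order \<open>\<alpha>\<close>: it yields \<open>\<bar>q - (1 + \<alpha>) * f\<bar> < \<bar>q + (1 - \<alpha>) * f\<bar>\<close>, which is equivalent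
  to \<open>\<alpha> < Re (q / f)\<close>.
\<close>

section \<open>Power series on the unit disc and the derivative along circles\<close>

text \<open>All indices from 0 on are kept, unlike in the tails that describe a harmonic
  decomposition, so that differentiation and Hadamard products act index by index.\<close>

definition disc_series :: "(nat \<Rightarrow> complex) \<Rightarrow> (complex \<Rightarrow> complex) \<Rightarrow> bool" where
  "disc_series a h \<longleftrightarrow> (\<forall>z\<in>ball 0 1. (\<lambda>n. a n * z ^ n) sums h z)"

text \<open>The derivative of \<open>h + cnj g\<close> in the angle is \<open>\<i>\<close> times
  this; dropping the factor turns the imaginary part of a logarithmic derivative into a real
  part.\<close>

definition circle_deriv :: "(complex \<Rightarrow> complex) \<Rightarrow> (complex \<Rightarrow> complex) \<Rightarrow> complex \<Rightarrow> complex" where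
  "circle_deriv h g z = z * deriv h z - cnj (z * deriv g z)"

section \<open>The derivative of the argument along a circle\<close>

text \<open>Multiplying \<open>F\<close> by \<open>exp (- \<i> * \<phi>)\<close> gives the real
  function \<open>norm F\<close> near \<open>t\<close>, so the derivative of the product is real. By
  the product rule its imaginary part is \<open>norm (F t)\<close> times
  \<open>Im (F' / F t) - D\<close>.\<close>

lemma arg_branch_derivative:
  fixes F :: "real \<Rightarrow> complex"
  assumes F: "(F has_vector_derivative F') (at t)" and nz: "F t \<noteq> 0"
    and br: "\<forall>\<^sub>F s in nhds t. F s = rcis (norm (F s)) (\<phi> s)"
    and \<phi>: "(\<phi> has_real_derivative D) (at t)"
  shows "D = Im (F' / F t)"
proof -
  define e where "e = (\<lambda>s. exp (- \<i> * of_real (\<phi> s)))"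
  have e: "(e has_vector_derivative (- \<i> * of_real D * e t)) (at t)"
  proof -
    have "((\<lambda>s. - \<i> * of_real (\<phi> s)) has_vector_derivative - \<i> * of_real D) (at t)"
      by (intro derivative_intros has_vector_derivative_of_real)
         (use \<phi> in \<open>simp add: has_real_derivative_iff_has_vector_derivative\<close>)
    from field_vector_diff_chain_at[OF this DERIV_exp] show ?thesis
      by (simp add: e_def o_def)
  qed
  have G: "((\<lambda>s. F s * e s) has_vector_derivative F t * (- \<i> * of_real D * e t) + F' * e t) (at t)"
    by (rule has_vector_derivative_mult[OF F e])
  have Fe: "F s * e s = of_real (norm (F s))" if "F s = rcis (norm (F s)) (\<phi> s)" for s
  proof -
    have "F s * e s = of_real (norm (F s)) * (cis (\<phi> s) * e s)"
      by (subst that) (simp add: rcis_def)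
    also have "cis (\<phi> s) * e s = 1"
      by (simp add: e_def cis_conv_exp flip: exp_add)
    finally show ?thesis by simp
  qed
  have Im: "((\<lambda>s. Im (F s * e s)) has_vector_derivative
      Im (F t * (- \<i> * of_real D * e t) + F' * e t)) (at t)"
    by (rule bounded_linear.has_vector_derivative[OF bounded_linear_Im G])
  have ev: "\<forall>\<^sub>F s in nhds t. Im (F s * e s) = 0"
    using br by eventually_elim (use Fe in auto)
  have "((\<lambda>s. 0) has_vector_derivative Im (F t * (- \<i> * of_real D * e t) + F' * e t)) (at t)"
    using Im
    by (rule iffD1[OF has_vector_derivative_cong_ev, rotated 2])
       (use ev eventually_nhds_x_imp_x[OF ev] in auto)
  hence "Im (F t * (- \<i> * of_real D * e t) + F' * e t) = 0"
    using vector_derivative_unique_at has_vector_derivative_const by blast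
  also have "F t * (- \<i> * of_real D * e t) + F' * e t = (F t * e t) * (F' / F t - \<i> * of_real D)"
    using nz by (simp add: field_simps)
  also have "F t * e t = of_real (norm (F t))"
    using Fe eventually_nhds_x_imp_x[OF br] by blast
  finally show ?thesis using nz by simp
qed

text \<open>The quotient \<open>F s / F t\<close> equals 1 at \<open>s = t\<close>, away from the
  branch cut of \<open>Ln\<close>, so adding the imaginary part of its logarithm to
  \<open>Arg (F t)\<close> gives a differentiable branch wherever \<open>F t\<close> lies.\<close>

lemma arg_branch_exists:
  fixes F :: "real \<Rightarrow> complex"
  assumes F: "(F has_vector_derivative F') (at t)" and nz: "F t \<noteq> 0"
  obtains \<phi> where "\<forall>\<^sub>F s in nhds t. F s = rcis (norm (F s)) (\<phi> s)"
    "(\<phi> has_real_derivative Im (F' / F t)) (at t)"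
proof
  define \<phi> where "\<phi> = (\<lambda>s. Arg (F t) + Im (Ln (F s / F t)))"
  have "((\<lambda>s. F s / F t) has_vector_derivative F' / F t) (at t)"
    using F by (rule has_vector_derivative_divide)
  moreover have "(Ln has_field_derivative 1) (at (F t / F t))"
    using nz has_field_derivative_Ln[of 1] by simp
  ultimately have "((Ln \<circ> (\<lambda>s. F s / F t)) has_vector_derivative F' / F t * 1) (at t)"
    by (rule field_vector_diff_chain_at)
  from bounded_linear.has_vector_derivative[OF bounded_linear_Im this]
  show "(\<phi> has_real_derivative Im (F' / F t)) (at t)"
    unfolding \<phi>_def has_real_derivative_iff_has_vector_derivative
    by (auto intro!: derivative_eq_intros simp: o_def)
  have "isCont F t" using F has_vector_derivative_continuous by blast
  hence "\<forall>\<^sub>F s in at t. F s \<noteq> 0"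
    using nz by (simp add: continuous_at tendsto_imp_eventually_ne)
  hence "\<forall>\<^sub>F s in nhds t. F s \<noteq> 0"
    unfolding eventually_at_filter by (rule eventually_mono) (use nz in auto)
  thus "\<forall>\<^sub>F s in nhds t. F s = rcis (norm (F s)) (\<phi> s)"
  proof eventually_elim
    case (elim s)
    have "F s = F t * (F s / F t)" using nz by simp
    also have "F t = rcis (norm (F t)) (Arg (F t))" by (simp add: rcis_cmod_Arg)
    \<comment> \<open>The preceding substitution also rewrote the denominator; this restores
      it.\<close>
    also have "F s / rcis (norm (F t)) (Arg (F t)) = F s / F t" by (simp add: rcis_cmod_Arg)
    also have "F s / F t = rcis (norm (F s / F t)) (Im (Ln (F s / F t)))"
      using elim nz by (metis Arg_eq_Im_Ln divide_eq_0_iff rcis_cmod_Arg)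
    finally show ?case using nz
      by (simp add: \<phi>_def rcis_mult norm_divide)
  qed
qed

lemma circle_has_vector_derivative:
  assumes h: "h holomorphic_on ball 0 1" and g: "g holomorphic_on ball 0 1"
    and r: "0 \<le> r" "r < 1"
  shows "((\<lambda>t. h (rcis r t) + cnj (g (rcis r t))) has_vector_derivative
     \<i> * circle_deriv h g (rcis r t)) (at t)"
proof -
  have z: "rcis r t \<in> ball 0 1" using r by simp
  have c: "(rcis r has_vector_derivative \<i> * rcis r t) (at t)"
  proof -
    have "((\<lambda>s. \<i> * of_real s) has_vector_derivative \<i> * 1) (at t)"
      by (intro derivative_intros has_vector_derivative_of_real has_vector_derivative_id)
         (auto intro!: derivative_eq_intros)
    moreover have "((\<lambda>w. of_real r * exp w) has_field_derivative of_real r * exp (\<i> * of_real t)) (at (\<i> * of_real t))"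
      by (auto intro!: derivative_eq_intros)
    ultimately have "(((\<lambda>w. of_real r * exp w) \<circ> (\<lambda>s. \<i> * of_real s)) has_vector_derivative
       \<i> * 1 * (of_real r * exp (\<i> * of_real t))) (at t)"
      by (rule field_vector_diff_chain_at)
    thus ?thesis by (simp add: o_def rcis_def[abs_def] cis_conv_exp)
  qed
  have *: "((\<lambda>t. k (rcis r t)) has_vector_derivative \<i> * (rcis r t * deriv k (rcis r t))) (at t)"
    if "k holomorphic_on ball 0 1" for k
    using field_vector_diff_chain_at[OF c holomorphic_derivI[OF that open_ball z]]
    by (simp add: o_def mult.assoc)
  show ?thesis
    using has_vector_derivative_add[OF *[OF h] has_vector_derivative_cnj[OF *[OF g]]]
    by (simp add: circle_deriv_def algebra_simps)
qed

text \<open>A branch exists at every nonzero value and its derivative is forced, so the quantified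
  branch reduces to an inequality at each point of the punctured disc.\<close>

lemma HS_star_iff:
  assumes d: "harmonic_decomp f h g"
  shows "f \<in> HS_star \<alpha> \<longleftrightarrow>
    (\<forall>z\<in>ball 0 1 - {0}. f z \<noteq> 0 \<and> \<alpha> < Re (circle_deriv h g z / f z))"
proof -
  have hol: "h holomorphic_on ball 0 1" "g holomorphic_on ball 0 1"
    and f: "\<And>z. z \<in> ball 0 1 \<Longrightarrow> f z = h z + cnj (g z)"
    using d by (auto simp: harmonic_decomp_def)
  have vd: "((\<lambda>t. f (rcis r t)) has_vector_derivative \<i> * circle_deriv h g (rcis r t)) (at t)"
    if "0 < r" "r < 1" for r t
    using circle_has_vector_derivative[OF hol, of r t] that f by simp
  have Im: "Im (\<i> * w / v) = Re (w / v)" for w v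
    by (metis Im_i_times times_divide_eq_right)
  define P where "P r t \<longleftrightarrow> (\<exists>\<phi> D. (\<forall>\<^sub>F s in nhds t. f (rcis r s) = rcis (norm (f (rcis r s))) (\<phi> s)) \<and>
      (\<phi> has_real_derivative D) (at t) \<and> \<alpha> < D)" for r t
  have P: "P r t \<longleftrightarrow> \<alpha> < Re (circle_deriv h g (rcis r t) / f (rcis r t))"
    if "0 < r" "r < 1" "f (rcis r t) \<noteq> 0" for r t
  proof
    assume "P r t"
    thus "\<alpha> < Re (circle_deriv h g (rcis r t) / f (rcis r t))"
      using arg_branch_derivative[OF vd[OF that(1,2)] that(3)] unfolding P_def Im by metis
  next
    assume "\<alpha> < Re (circle_deriv h g (rcis r t) / f (rcis r t))"
    thus "P r t"
      using arg_branch_exists[OF vd[OF that(1,2)] that(3)] unfolding P_def Im by metis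
  qed
  have "f \<in> H_hat" using d by (auto simp: H_hat_def)
  hence "f \<in> HS_star \<alpha> \<longleftrightarrow> (\<forall>r t. 0 < r \<longrightarrow> r < 1 \<longrightarrow> 0 \<le> t \<longrightarrow> t \<le> 2 * pi \<longrightarrow>
      f (rcis r t) \<noteq> 0 \<and> P r t)"
    unfolding HS_star_def P_def by simp
  also have "\<dots> \<longleftrightarrow> (\<forall>r t. 0 < r \<longrightarrow> r < 1 \<longrightarrow> 0 \<le> t \<longrightarrow> t \<le> 2 * pi \<longrightarrow>
      f (rcis r t) \<noteq> 0 \<and> \<alpha> < Re (circle_deriv h g (rcis r t) / f (rcis r t)))"
    using P by meson
  also have "\<dots> \<longleftrightarrow> (\<forall>z\<in>ball 0 1 - {0}. f z \<noteq> 0 \<and> \<alpha> < Re (circle_deriv h g z / f z))"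
  proof (intro iffI ballI allI impI)
    fix z :: complex assume *: "\<forall>r t. 0 < r \<longrightarrow> r < 1 \<longrightarrow> 0 \<le> t \<longrightarrow> t \<le> 2 * pi \<longrightarrow>
      f (rcis r t) \<noteq> 0 \<and> \<alpha> < Re (circle_deriv h g (rcis r t) / f (rcis r t))"
      and z: "z \<in> ball 0 1 - {0}"
    \<comment> \<open>\<open>Arg2pi\<close> takes values between 0 and \<open>2 * pi\<close>, the
      range of angles in the definition.\<close>
    have "z = rcis (norm z) (Arg2pi z)"
      using Arg2pi_eq[of z] by (simp add: rcis_def cis_conv_exp)
    with *[rule_format, of "norm z" "Arg2pi z"] z Arg2pi_ge_0[of z] Arg2pi_lt_2pi[of z]
    show "f z \<noteq> 0 \<and> \<alpha> < Re (circle_deriv h g z / f z)" by simp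
  qed auto
  finally show ?thesis .
qed

section \<open>Coefficients: derivatives, Hadamard products, uniqueness of the decomposition\<close>

lemma disc_series_holomorphic: "disc_series a h \<Longrightarrow> h holomorphic_on ball 0 1"
  unfolding disc_series_def by (rule power_series_holomorphic[of 0 1 a]) simp

text \<open>The factor \<open>z\<close> realigns the differentiated series with the index of the
  original one; the new term at index 0 vanishes.\<close>

lemma disc_series_deriv:
  assumes "disc_series a h" and z: "z \<in> ball 0 1"
  shows "(\<lambda>n. of_nat n * a n * z ^ n) sums (z * deriv h z)"
proof -
  have "(\<lambda>n. diffs a n * z ^ n) sums deriv h z"
    using assms holomorphic_derivI[OF disc_series_holomorphic[OF assms(1)] open_ball z]
    by (intro termdiffs_sums_strong[of 1 a h]) (auto simp: disc_series_def)
  from sums_mult[OF this, of z] have "(\<lambda>n. of_nat (Suc n) * a (Suc n) * z ^ Suc n) sums (z * deriv h z)"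
    by (simp add: diffs_def mult_ac)
  thus ?thesis by (subst (asm) sums_Suc_iff) simp
qed

text \<open>Gives access to \<open>hadamard\<close>, which is defined through formal expansions at
  0.\<close>

lemma disc_series_fps_expansion:
  assumes "disc_series a h"
  shows "fps_expansion h 0 = Abs_fps a"
proof (rule fps_expansion_eqI)
  have "fps_conv_radius (Abs_fps a) \<ge> 1"
    unfolding fps_conv_radius_def
  proof (rule conv_radius_geI_ex)
    fix r :: real assume "0 < r" "ereal r < 1"
    thus "\<exists>z. norm z = r \<and> summable (\<lambda>n. fps_nth (Abs_fps a) n * z ^ n)"
      using assms by (intro exI[of _ "of_real r"]) (auto simp: disc_series_def sums_iff)
  qed
  moreover have "\<forall>\<^sub>F z in nhds 0. eval_fps (Abs_fps a) z = h z"
    using eventually_nhds_in_open[of "ball 0 1" "0::complex"]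
    by (rule eventually_mono) (use assms in \<open>auto simp: disc_series_def eval_fps_def sums_iff\<close>)
  ultimately show "h has_fps_expansion Abs_fps a"
    unfolding has_fps_expansion_def using less_le_trans[of 0 1 "fps_conv_radius (Abs_fps a)"] by simp
qed

lemma disc_series_of_summable:
  fixes a :: "nat \<Rightarrow> complex"
  assumes "summable (\<lambda>n. norm (a n))" "z \<in> ball 0 1"
  shows "summable (\<lambda>n. a n * z ^ n)"
  using assms by (intro powser_inside[of a 1 z]) (auto intro: summable_norm_cancel)

lemma hadamard_disc_series:
  assumes "disc_series a h" "disc_series c k" "summable (\<lambda>n. norm (a n * c n))"
  shows "disc_series (\<lambda>n. a n * c n) (hadamard h k)"
  unfolding disc_series_def hadamard_def eval_fps_def
  using disc_series_of_summable[OF assms(3)] assms(1,2)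
  by (auto simp: disc_series_fps_expansion intro!: summable_sums)

text \<open>The difference \<open>p\<close> of the analytic parts is the conjugate of a holomorphic
  function. Its derivative is thus both linear and conjugate linear, hence 0, and the constant is
  fixed by the values at 0.\<close>

lemma harmonic_decomp_unique:
  assumes "harmonic_decomp f h g" "harmonic_decomp f h' g'"
    and "z \<in> ball 0 1"
    and z0: "h 0 = 0" "g 0 = 0" "h' 0 = 0" "g' 0 = 0"
  shows "h z = h' z" "g z = g' z"
proof -
  define p where "p = (\<lambda>z. h z - h' z)"
  define q where "q = (\<lambda>z. g' z - g z)"
  have hol: "p holomorphic_on ball 0 1" "q holomorphic_on ball 0 1"
    using assms by (auto simp: p_def q_def harmonic_decomp_def intro!: holomorphic_intros)
  have pq: "p w = cnj (q w)" if "w \<in> ball 0 1" for w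
    using assms(1,2) that by (auto simp: p_def q_def harmonic_decomp_def algebra_simps)
  have "deriv p w = 0" if w: "w \<in> ball 0 1" for w
  proof -
    have "(p has_derivative (*) (deriv p w)) (at w)"
      using holomorphic_derivI[OF hol(1) open_ball w] by (simp add: has_field_derivative_def)
    hence 1: "((\<lambda>w. cnj (q w)) has_derivative (*) (deriv p w)) (at w)"
      by (rule has_derivative_transform_within_open[OF _ open_ball w pq])
    have "(q has_derivative (*) (deriv q w)) (at w)"
      using holomorphic_derivI[OF hol(2) open_ball w] by (simp add: has_field_derivative_def)
    from bounded_linear.has_derivative[OF bounded_linear_cnj this]
    have "((\<lambda>w. cnj (q w)) has_derivative (\<lambda>v. cnj (deriv q w * v))) (at w)" .
    from fun_cong[OF has_derivative_unique[OF 1 this]]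
    have "deriv p w * v = cnj (deriv q w * v)" for v .
    \<comment> \<open>The directions 1 and \<open>\<i>\<close> give \<open>deriv p w\<close> as a
      conjugate and as minus the same conjugate.\<close>
    from this[of 1] this[of \<i>] show ?thesis by (simp add: complex_eq_iff)
  qed
  hence "(p has_field_derivative 0) (at w within ball 0 1)" if "w \<in> ball 0 1" for w
    using holomorphic_derivI[OF hol(1) open_ball that] that
    by (metis has_field_derivative_at_within)
  then obtain c where c: "\<And>w. w \<in> ball 0 1 \<Longrightarrow> p w = c"
    using has_field_derivative_zero_constant[of "ball 0 1" p] by auto
  have "p z = 0" using c[OF assms(3)] c[of 0] z0 by (simp add: p_def)
  moreover from this pq[OF assms(3)] have "q z = 0" by simp
  ultimately show "h z = h' z" "g z = g' z" by (auto simp: p_def q_def)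
qed

lemma disc_series_iff_tail2:
  assumes "a 0 = 0" "a 1 = 1"
  shows "disc_series a h \<longleftrightarrow> (\<forall>z\<in>ball 0 1. (\<lambda>n. a (n + 2) * z ^ (n + 2)) sums (h z - z))"
  unfolding disc_series_def using assms
  by (subst sums_iff_shift) (simp add: numeral_2_eq_2)

lemma disc_series_iff_tail1:
  assumes "b 0 = 0"
  shows "disc_series b g \<longleftrightarrow> (\<forall>z\<in>ball 0 1. (\<lambda>n. b (n + 1) * z ^ (n + 1)) sums g z)"
  unfolding disc_series_def using assms
  by (subst sums_iff_shift) simp

lemma disc_series_0: "disc_series a h \<Longrightarrow> h 0 = a 0"
  unfolding disc_series_def by (metis centre_in_ball powser_sums_zero_iff zero_less_one)

lemma disc_series_deriv_0: "disc_series a h \<Longrightarrow> deriv h 0 = a 1"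
  using disc_series_fps_expansion[of a h]
  by (auto simp: fps_expansion_def fps_eq_iff dest: spec[of _ 1])

lemma harmonic_decompI:
  assumes "disc_series a h" "disc_series b g" "a 0 = 0" "a 1 = 1" "b 0 = 0" "norm (b 1) < 1"
    and "\<And>z. z \<in> ball 0 1 \<Longrightarrow> f z = h z + cnj (g z)"
  shows "harmonic_decomp f h g"
  using assms disc_series_iff_tail2[of a h] disc_series_iff_tail1[of b g]
  unfolding harmonic_decomp_def by (blast intro: disc_series_holomorphic)

lemma harmonic_decomp_at_0:
  assumes "harmonic_decomp f h g"
  shows "h 0 = 0" "g 0 = 0"
proof -
  from assms obtain A B :: "nat \<Rightarrow> complex" where
    "\<forall>z\<in>ball 0 1. (\<lambda>n. A (n + 2) * z ^ (n + 2)) sums (h z - z) \<and>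
                      (\<lambda>n. B (n + 1) * z ^ (n + 1)) sums g z"
    unfolding harmonic_decomp_def by blast
  from bspec[OF this, of 0] show "h 0 = 0" "g 0 = 0"
    by (auto simp: sums_iff)
qed

text \<open>The sign conditions in \<open>SRH\<close> concern some decomposition of
  \<open>f\<close>; uniqueness carries them over to the given one.\<close>

lemma SRH_coeffs:
  assumes "f \<in> SRH \<alpha>" and d: "harmonic_decomp f h g"
  obtains a b where "disc_series a h" "disc_series b g" "a 0 = 0" "a 1 = 1" "b 0 = 0"
    "norm (b 1) < 1" "\<And>n. n \<ge> 2 \<Longrightarrow> a n = - of_real (norm (a n))"
    "\<And>n. b n = of_real (norm (b n))"
proof -
  from assms obtain h' g' and A B :: "nat \<Rightarrow> complex" where
    d': "harmonic_decomp f h' g'" and B: "norm (B 1) < 1"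
    and s: "\<And>z. z \<in> ball 0 1 \<Longrightarrow> (\<lambda>n. of_real (norm (A (n + 2))) * z ^ (n + 2)) sums (z - h' z)"
           "\<And>z. z \<in> ball 0 1 \<Longrightarrow> (\<lambda>n. of_real (norm (B (n + 1))) * z ^ (n + 1)) sums g' z"
    unfolding SRH_def by blast
  have eq: "h z = h' z" "g z = g' z" if "z \<in> ball 0 1" for z
    using harmonic_decomp_unique[OF d d' that] harmonic_decomp_at_0[OF d] harmonic_decomp_at_0[OF d']
    by auto
  define a where "a n = (if n = 0 then 0 else if n = 1 then 1 else - complex_of_real (norm (A n)))" for n
  define b where "b n = (if n = 0 then 0 else complex_of_real (norm (B n)))" for n
  show thesis
  proof (rule that[of a b])
    have "(\<lambda>n. a (n + 2) * z ^ (n + 2)) sums (h z - z)" if "z \<in> ball 0 1" for z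
      using sums_minus[OF s(1)[OF that]] eq[OF that] by (simp add: a_def)
    thus "disc_series a h" by (subst disc_series_iff_tail2) (auto simp: a_def)
    have "(\<lambda>n. b (n + 1) * z ^ (n + 1)) sums g z" if "z \<in> ball 0 1" for z
      using s(2)[OF that] eq[OF that] by (simp add: b_def)
    thus "disc_series b g" by (subst disc_series_iff_tail1) (auto simp: b_def)
  qed (use B in \<open>auto simp: a_def b_def\<close>)
qed

section \<open>Starlikeness bounds each coefficient\<close>

text \<open>For the sign pattern of \<open>SRH\<close> these are, up to sign, the coefficients of
  \<open>q - \<alpha> * f\<close> on the positive radius. The leading term \<open>z\<close> of
  \<open>h\<close> is left out; its contribution \<open>1 - \<alpha>\<close> is the bound on the
  other side.\<close>

definition coeff_weight :: "real \<Rightarrow> (nat \<Rightarrow> complex) \<Rightarrow> (nat \<Rightarrow> complex) \<Rightarrow> nat \<Rightarrow> real" where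
  "coeff_weight \<alpha> a b n =
     (if n < 2 then 0 else (real n - \<alpha>) * norm (a n)) + (real n + \<alpha>) * norm (b n)"

lemma coeff_weight_nonneg: "0 \<le> \<alpha> \<Longrightarrow> \<alpha> < 1 \<Longrightarrow> 0 \<le> coeff_weight \<alpha> a b n"
  unfolding coeff_weight_def by auto

text \<open>Intermediate values: the real part vanishes at 0, where its derivative is \<open>1 + b 1 > 0\<close>.\<close>

lemma Re_pos_of_real_coeffs:
  assumes "disc_series a h" "disc_series b g" "a 0 = 0" "a 1 = 1" "b 0 = 0"
    and b1: "b 1 = of_real (norm (b 1))"
    and nz: "\<And>x. 0 < x \<Longrightarrow> x < 1 \<Longrightarrow> Re (h (of_real x) + cnj (g (of_real x))) \<noteq> 0"
    and r: "0 < r" "r < 1"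
  shows "Re (h (of_real r) + cnj (g (of_real r))) > 0"
proof (rule ccontr)
  define F where "F x = Re (h (of_real x) + cnj (g (of_real x)))" for x :: real
  have hol: "h holomorphic_on ball 0 1" "g holomorphic_on ball 0 1"
    using assms(1,2) disc_series_holomorphic by auto
  have v: "((\<lambda>x. k (of_real x)) has_vector_derivative deriv k 0) (at 0)"
    if "k holomorphic_on ball 0 1" for k
    using field_vector_diff_chain_at[OF has_vector_derivative_of_real[OF DERIV_ident],
        where g = k and g' = "deriv k 0" and x = 0]
      holomorphic_derivI[OF that, of 0]
    by (simp add: o_def)
  have "((\<lambda>x. h (of_real x) + cnj (g (of_real x))) has_vector_derivative
      deriv h 0 + cnj (deriv g 0)) (at 0)"
    by (intro has_vector_derivative_add has_vector_derivative_cnj v hol)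
  from bounded_linear.has_vector_derivative[OF bounded_linear_Re this]
  have "(F has_real_derivative Re (1 + cnj (b 1))) (at 0)"
    using disc_series_deriv_0[OF assms(1)] disc_series_deriv_0[OF assms(2)] assms(4)
    by (simp add: F_def[abs_def] has_real_derivative_iff_has_vector_derivative)
  moreover have "Re (1 + cnj (b 1)) > 0" by (subst b1) (simp add: add_pos_nonneg)
  ultimately obtain e where e: "e > 0" "\<And>x. 0 < x \<Longrightarrow> x < e \<Longrightarrow> F 0 < F x"
    using DERIV_pos_inc_right[of F _ 0] by auto
  have F0: "F 0 = 0"
    using disc_series_0[OF assms(1)] disc_series_0[OF assms(2)] assms by (simp add: F_def)
  \<comment> \<open>A point below \<open>r\<close> where the positive derivative at 0 already makes
    \<open>F\<close> positive; a nonpositive \<open>F r\<close> would then force a zero in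
    between.\<close>
  define s where "s = min r e / 2"
  have s: "0 < s" "s < r" "s < e" using r e by (auto simp: s_def min_def)
  have Fs: "F s > 0" using e(2)[of s] s F0 by simp
  assume "\<not> ?thesis"
  hence Fr: "F r \<le> 0" by (simp add: F_def)
  have "continuous_on {s..r} F"
    unfolding F_def using s r
    by (intro continuous_intros
        continuous_on_compose2[OF holomorphic_on_imp_continuous_on[OF hol(1)]]
        continuous_on_compose2[OF holomorphic_on_imp_continuous_on[OF hol(2)]]) auto
  then obtain x where "s \<le> x" "x \<le> r" "F x = 0"
    using IVT2'[of F r 0 s] Fs Fr s by auto
  thus False using nz[of x] s r by (auto simp: F_def)
qed

text \<open>On the positive radius \<open>f\<close> is positive, so the inequality can be multiplied
  by \<open>f\<close>: the weighted series at \<open>r\<close> stays below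
  \<open>(1 - \<alpha>) * r\<close>. Its terms are nonnegative, so each one obeys this
  bound.\<close>

lemma coeff_weight_le_of_HS_star:
  assumes f: "f \<in> HS_star \<alpha>" and d: "harmonic_decomp f h g"
    and ab: "disc_series a h" "disc_series b g" "a 0 = 0" "a 1 = 1" "b 0 = 0"
    and a: "\<And>n. n \<ge> 2 \<Longrightarrow> a n = - of_real (norm (a n))"
    and b: "\<And>n. b n = of_real (norm (b n))"
    and \<alpha>: "0 \<le> \<alpha>" "\<alpha> < 1"
  shows "coeff_weight \<alpha> a b N \<le> 1 - \<alpha>"
proof -
  let ?c = "coeff_weight \<alpha> a b"
  have fz: "f z = h z + cnj (g z)" if "z \<in> ball 0 1" for z
    using d that by (simp add: harmonic_decomp_def)
  have Ima: "Im (a n) = 0" for n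
    using a[of n] ab by (cases "n < 2") (auto simp: less_2_cases_iff complex_eq_iff)
  have Imb: "Im (b n) = 0" for n using b[of n] by (metis Im_complex_of_real)
  have Imz: "Im (c * of_real x ^ n) = 0" if "Im c = 0" for c n and x :: real
    using that by (simp flip: of_real_power)
  have term_eq: "(of_nat n * a n * z ^ n - cnj (of_nat n * b n * z ^ n))
           - of_real \<alpha> * (a n * z ^ n + cnj (b n * z ^ n))
       = of_real (((if n = 1 then 1 - \<alpha> else 0) - ?c n) * r ^ n)"
    if z: "z = of_real r" for n r z
  proof -
    have bn: "cnj (b n) = of_real (norm (b n))" "b n = of_real (norm (b n))"
      using b[of n] by (metis complex_cnj_complex_of_real)+
    consider "n = 0" | "n = 1" | "n \<ge> 2" by linarith
    thus ?thesis
    proof cases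
      case 1 thus ?thesis using ab by (simp add: coeff_weight_def)
    next
      case 2 thus ?thesis using ab bn z by (simp add: coeff_weight_def algebra_simps)
    next
      case 3
      from a[OF 3] obtain x where "a n = - of_real x" "norm (a n) = x" by blast
      thus ?thesis using bn(1) 3 z
        by (simp add: coeff_weight_def algebra_simps)
    qed
  qed
  have Imf: "Im (f (of_real x)) = 0" if x: "0 < x" "x < 1" for x
  proof -
    have "of_real x \<in> ball (0::complex) 1" using x by simp
    from sums_Im[OF sums_add[OF ab(1)[unfolded disc_series_def, rule_format, OF this]
          iffD2[OF sums_cnj ab(2)[unfolded disc_series_def, rule_format, OF this]]]] fz[OF this]
    have "(\<lambda>n. Im (a n * of_real x ^ n) - Im (b n * of_real x ^ n)) sums Im (f (of_real x))"
      by simp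
    thus ?thesis by (simp only: Imz[OF Ima] Imz[OF Imb]) (simp add: sums_iff)
  qed
  have cond: "f z \<noteq> 0" "\<alpha> < Re (circle_deriv h g z / f z)" if "z \<in> ball 0 1 - {0}" for z
    using f HS_star_iff[OF d, of \<alpha>] that by auto
  have bound: "?c N * r ^ N \<le> 1 - \<alpha>" if r: "0 < r" "r < 1" for r
  proof -
    define z where "z = complex_of_real r"
    have z: "z \<in> ball 0 1" "z \<in> ball 0 1 - {0}" using r by (auto simp: z_def)
    have nz: "Re (h (of_real x) + cnj (g (of_real x))) \<noteq> 0" if "0 < x" "x < 1" for x
      using cond(1)[of "of_real x"] Imf[OF that] fz[of "of_real x"] that
      by (auto simp: complex_eq_iff)
    have pos: "Re (f z) > 0"
      using Re_pos_of_real_coeffs[OF ab b nz r] fz[OF z(1)] by (simp add: z_def)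
    have fre: "f z = of_real (Re (f z))"
      using Imf[OF r] by (simp add: complex_eq_iff z_def)
    have "Re (circle_deriv h g z / f z) = Re (circle_deriv h g z) / Re (f z)"
      by (subst fre) simp
    with cond(2)[OF z(2)] pos have "\<alpha> * Re (f z) < Re (circle_deriv h g z)"
      by (simp add: field_simps)
    moreover have "(\<lambda>n. ((if n = 1 then 1 - \<alpha> else 0) - ?c n) * r ^ n) sums
        Re (circle_deriv h g z - of_real \<alpha> * f z)"
    proof -
      have "(\<lambda>n. (of_nat n * a n * z ^ n - cnj (of_nat n * b n * z ^ n))
           - of_real \<alpha> * (a n * z ^ n + cnj (b n * z ^ n))) sums
          (circle_deriv h g z - of_real \<alpha> * f z)"
        unfolding circle_deriv_def fz[OF z(1)]
        by (intro sums_diff sums_mult sums_add iffD2[OF sums_cnj] disc_series_deriv ab z)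
           (use ab z in \<open>auto simp: disc_series_def\<close>)
      from sums_Re[OF this] show ?thesis
        by (simp only: term_eq[OF z_def] Re_complex_of_real)
    qed
    moreover have "(\<lambda>n. (if n = 1 then 1 - \<alpha> else 0) * r ^ n) sums ((1 - \<alpha>) * r)"
      using sums_single[of 1 "\<lambda>n. (1 - \<alpha>) * r ^ n"] by (simp add: if_distrib[of "\<lambda>x. x * _"] cong: if_cong)
    ultimately have "(\<lambda>n. (if n = 1 then 1 - \<alpha> else 0) * r ^ n
          - ((if n = 1 then 1 - \<alpha> else 0) - ?c n) * r ^ n) sums
        ((1 - \<alpha>) * r - Re (circle_deriv h g z - of_real \<alpha> * f z))"
      by (intro sums_diff)
    hence S: "(\<lambda>n. ?c n * r ^ n) sums
        ((1 - \<alpha>) * r - Re (circle_deriv h g z - of_real \<alpha> * f z))"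
      by (simp add: left_diff_distrib)
    have "?c N * r ^ N \<le> (\<Sum>n. ?c n * r ^ n)"
      using sum_le_suminf[of "\<lambda>n. ?c n * r ^ n" "{N}"] S coeff_weight_nonneg[OF \<alpha>] r
      by (auto simp: sums_iff)
    also have "\<dots> \<le> (1 - \<alpha>) * r"
      using S \<open>\<alpha> * Re (f z) < Re (circle_deriv h g z)\<close> by (simp add: sums_iff)
    also have "\<dots> \<le> 1 - \<alpha>" using \<alpha> r by (simp add: mult_left_le)
    finally show ?thesis .
  qed
  have "((\<lambda>r. ?c N * r ^ N) \<longlongrightarrow> ?c N * 1 ^ N) (at_left (1::real))"
    by (intro tendsto_intros)
  moreover have "\<forall>\<^sub>F r in at_left (1::real). ?c N * r ^ N \<le> 1 - \<alpha>"
    using eventually_at_left_real[OF zero_less_one] by (rule eventually_mono) (use bound in auto)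
  ultimately show ?thesis
    using tendsto_upperbound trivial_limit_at_left_real by fastforce
qed

section \<open>Coefficient bounds imply starlikeness\<close>

text \<open>After division by \<open>p\<close>, the point \<open>q / p\<close> is closer to
  \<open>1 + \<alpha>\<close> than to \<open>\<alpha> - 1\<close>, and the perpendicular bisector of
  these two is the line of real part \<open>\<alpha>\<close>. For \<open>p = 0\<close> both norms
  would agree.\<close>

lemma Re_divide_gt_of_norm_less:
  assumes "norm (q - of_real (1 + \<alpha>) * p) < norm (q + of_real (1 - \<alpha>) * p)"
  shows "p \<noteq> 0" "\<alpha> < Re (q / p)"
proof -
  show p: "p \<noteq> 0" using assms by auto
  have "(norm (q - of_real (1 + \<alpha>) * p))\<^sup>2 < (norm (q + of_real (1 - \<alpha>) * p))\<^sup>2"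
    using assms by (intro power_strict_mono) auto
  hence "\<alpha> * (norm p)\<^sup>2 < Re q * Re p + Im q * Im p"
    unfolding cmod_power2 by (simp add: power2_eq_square algebra_simps)
  moreover have "(norm p)\<^sup>2 > 0" using p by simp
  ultimately show "\<alpha> < Re (q / p)"
    by (simp add: Re_divide cmod_power2 field_simps)
qed

text \<open>
  The strict bound on the weight of index 1 is necessary: for \<open>\<alpha> > 0\<close> and
  \<open>b = (1 - \<alpha>) / (1 + \<alpha>)\<close>, the argument of \<open>z + b * cnj z\<close> has angular derivative exactly \<open>\<alpha>\<close> somewhere.
  In the application it comes from \<open>\<bar>\<sigma>\<bar> < 1\<close>.
\<close>

lemma HS_star_of_coeff_weight:
  assumes d: "harmonic_decomp f h g"
    and ab: "disc_series a h" "disc_series b g" "a 0 = 0" "a 1 = 1" "b 0 = 0"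
    and \<alpha>: "0 \<le> \<alpha>" "\<alpha> < 1"
    and sm: "summable (coeff_weight \<alpha> a b)" and le: "(\<Sum>n. coeff_weight \<alpha> a b n) \<le> 1 - \<alpha>"
    and c1: "coeff_weight \<alpha> a b 1 < 1 - \<alpha>"
  shows "f \<in> HS_star \<alpha>"
proof -
  let ?c = "coeff_weight \<alpha> a b"
  have "f z \<noteq> 0 \<and> \<alpha> < Re (circle_deriv h g z / f z)" if z: "z \<in> ball 0 1" and z0: "z \<noteq> 0" for z
  proof -
    define r where "r = norm z"
    have r: "0 < r" "r < 1" using z z0 by (auto simp: r_def)
    have fz: "f z = h z + cnj (g z)" using d z by (simp add: harmonic_decomp_def)
    have hs: "(\<lambda>n. a n * z ^ n) sums h z" and gs: "(\<lambda>n. b n * z ^ n) sums g z"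
      using ab z by (auto simp: disc_series_def)
    \<comment> \<open>The term \<open>z\<close> of \<open>h\<close> is treated apart: it contributes
      \<open>(2 - \<alpha>) * z\<close> to \<open>q + (1 - \<alpha>) * f\<close> and
      \<open>- \<alpha> * z\<close> to \<open>q - (1 + \<alpha>) * f\<close>. The remaining
      coefficients of these two are bounded by \<open>x\<close> and \<open>y\<close>.\<close>
    define a' where "a' n = (if n < 2 then 0 else a n)" for n
    define x where "x n = (real n + 1 - \<alpha>) * norm (a' n) + \<bar>real n - (1 - \<alpha>)\<bar> * norm (b n)" for n
    define y where "y n = \<bar>real n - (1 + \<alpha>)\<bar> * norm (a' n) + (real n + 1 + \<alpha>) * norm (b n)" for n
    have xy: "x n + y n = 2 * ?c n" for n
    proof -
      consider "n = 0" | "n = 1" | "n \<ge> 2" by linarith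
      thus ?thesis
        by cases (use \<alpha> ab in \<open>auto simp: x_def y_def a'_def coeff_weight_def algebra_simps\<close>)
    qed
    have nonneg: "0 \<le> x n" "0 \<le> y n" for n using \<alpha> by (auto simp: x_def y_def)
    have c0: "?c 0 = 0" using ab by (simp add: coeff_weight_def)
    have smr: "summable (\<lambda>n. ?c n * r ^ n)"
      using sm by (rule summable_comparison_test')
        (use r coeff_weight_nonneg[OF \<alpha>] in \<open>auto simp: norm_mult power_le_one mult_left_le\<close>)
    have smx: "summable (\<lambda>n. x n * r ^ n)" and smy: "summable (\<lambda>n. y n * r ^ n)"
    proof -
      have sm2: "summable (\<lambda>n. 2 * (?c n * r ^ n))" using smr by (rule summable_mult)
      have "x n * r ^ n \<le> 2 * (?c n * r ^ n)" "y n * r ^ n \<le> 2 * (?c n * r ^ n)" for n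
        using mult_right_mono[of "x n" "2 * ?c n" "r ^ n"] mult_right_mono[of "y n" "2 * ?c n" "r ^ n"]
          xy[of n] nonneg[of n] r by (auto simp: mult.assoc)
      thus "summable (\<lambda>n. x n * r ^ n)" "summable (\<lambda>n. y n * r ^ n)"
        using nonneg r by (auto intro!: summable_comparison_test'[OF sm2])
    qed
    \<comment> \<open>Weights from index 2 on carry at most \<open>r\<^sup>2 < r\<close>. The strict
      bound on the weight of index 1 leaves them a positive share of \<open>1 - \<alpha>\<close>,
      which makes the inequality strict.\<close>
    have strict: "(\<Sum>n. ?c n * r ^ n) < (1 - \<alpha>) * r"
    proof -
      have tail: "(\<Sum>n. ?c n) = (\<Sum>n. ?c (n + 2)) + ?c 1"
        using suminf_split_initial_segment[OF sm, of 2] c0 by (simp add: numeral_2_eq_2)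
      have "(\<Sum>n. ?c n * r ^ n) = (\<Sum>n. ?c (n + 2) * r ^ (n + 2)) + ?c 1 * r"
        using suminf_split_initial_segment[OF smr, of 2] c0 by (simp add: numeral_2_eq_2)
      also have "(\<Sum>n. ?c (n + 2) * r ^ (n + 2)) \<le> (\<Sum>n. ?c (n + 2) * r\<^sup>2)"
      proof (rule suminf_le)
        show "?c (n + 2) * r ^ (n + 2) \<le> ?c (n + 2) * r\<^sup>2" for n
          using r coeff_weight_nonneg[OF \<alpha>] by (intro mult_left_mono power_decreasing) auto
        show "summable (\<lambda>n. ?c (n + 2) * r ^ (n + 2))"
          using smr by (rule summable_ignore_initial_segment)
        show "summable (\<lambda>n. ?c (n + 2) * r\<^sup>2)"
          using sm by (intro summable_mult2 summable_ignore_initial_segment)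
      qed
      also have "\<dots> = (\<Sum>n. ?c (n + 2)) * r\<^sup>2"
        using sm by (intro suminf_mult2[symmetric] summable_ignore_initial_segment)
      also have "\<dots> \<le> (1 - \<alpha> - ?c 1) * r\<^sup>2"
        using le tail by (intro mult_right_mono) auto
      also have "\<dots> < (1 - \<alpha> - ?c 1) * r"
        using c1 r by (intro mult_strict_left_mono) (auto simp: power2_eq_square)
      finally show ?thesis by (simp add: algebra_simps)
    qed
    have zs: "(\<lambda>n. if n = 1 then w * z ^ n else 0) sums (w * z)" for w
      using sums_single[of 1 "\<lambda>n. w * z ^ n"] by simp
    have nrm: "norm (s * a' n * z ^ n - cnj (t * b n * z ^ n)) \<le> (norm s * norm (a' n) + norm t * norm (b n)) * r ^ n"
      for s t :: complex and n
      by (rule order_trans[OF norm_triangle_ineq4])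
         (simp add: norm_mult norm_power r_def algebra_simps)
    let ?q = "circle_deriv h g z"
    have "(\<lambda>n. of_real (real n + 1 - \<alpha>) * a' n * z ^ n - cnj (of_real (real n - (1 - \<alpha>)) * b n * z ^ n))
        sums (?q + of_real (1 - \<alpha>) * f z - of_real (2 - \<alpha>) * z)"
    proof -
      have eq: "(of_nat n * a n * z ^ n - cnj (of_nat n * b n * z ^ n))
           + of_real (1 - \<alpha>) * (a n * z ^ n + cnj (b n * z ^ n))
           - (if n = 1 then of_real (2 - \<alpha>) * z ^ n else 0) =
          of_real (real n + 1 - \<alpha>) * a' n * z ^ n - cnj (of_real (real n - (1 - \<alpha>)) * b n * z ^ n)" for n
      proof -
        consider "n = 0" | "n = 1" | "n \<ge> 2" by linarith
        thus ?thesis by cases (use ab in \<open>auto simp: a'_def algebra_simps\<close>)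
      qed
      show ?thesis unfolding circle_deriv_def fz eq[symmetric]
        by (intro sums_diff sums_mult sums_add zs iffD2[OF sums_cnj] disc_series_deriv ab z hs gs)
    qed
    hence X: "norm (?q + of_real (1 - \<alpha>) * f z - of_real (2 - \<alpha>) * z) \<le> (\<Sum>n. x n * r ^ n)"
      by (rule norm_sums_le[OF _ summable_sums[OF smx]])
         (rule order_trans[OF nrm], use \<alpha> in \<open>simp add: x_def flip: of_real_diff of_real_add\<close>)
    have "(\<lambda>n. of_real (real n - (1 + \<alpha>)) * a' n * z ^ n - cnj (of_real (real n + 1 + \<alpha>) * b n * z ^ n))
        sums (?q - of_real (1 + \<alpha>) * f z - of_real (- \<alpha>) * z)"
    proof -
      have eq: "(of_nat n * a n * z ^ n - cnj (of_nat n * b n * z ^ n))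
           - of_real (1 + \<alpha>) * (a n * z ^ n + cnj (b n * z ^ n))
           - (if n = 1 then of_real (- \<alpha>) * z ^ n else 0) =
          of_real (real n - (1 + \<alpha>)) * a' n * z ^ n - cnj (of_real (real n + 1 + \<alpha>) * b n * z ^ n)" for n
      proof -
        consider "n = 0" | "n = 1" | "n \<ge> 2" by linarith
        thus ?thesis by cases (use ab in \<open>auto simp: a'_def algebra_simps\<close>)
      qed
      show ?thesis unfolding circle_deriv_def fz eq[symmetric]
        by (intro sums_diff sums_mult sums_add zs iffD2[OF sums_cnj] disc_series_deriv ab z hs gs)
    qed
    hence Y: "norm (?q - of_real (1 + \<alpha>) * f z - of_real (- \<alpha>) * z) \<le> (\<Sum>n. y n * r ^ n)"
      by (rule norm_sums_le[OF _ summable_sums[OF smy]])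
         (rule order_trans[OF nrm], use \<alpha> in \<open>simp add: y_def flip: of_real_diff of_real_add\<close>)
    have "(\<Sum>n. x n * r ^ n) + (\<Sum>n. y n * r ^ n) = (\<Sum>n. 2 * (?c n * r ^ n))"
      unfolding suminf_add[OF smx smy] by (simp add: xy mult.assoc flip: distrib_right)
    also have "\<dots> = 2 * (\<Sum>n. ?c n * r ^ n)" using smr by (rule suminf_mult)
    finally have XY: "(\<Sum>n. x n * r ^ n) + (\<Sum>n. y n * r ^ n) < 2 * ((1 - \<alpha>) * r)"
      using strict by simp
    have "norm (of_real (2 - \<alpha>) * z) = (2 - \<alpha>) * r" "norm (of_real (- \<alpha>) * z) = \<alpha> * r"
      using \<alpha> by (auto simp: norm_mult r_def simp del: of_real_diff of_real_minus)
    \<comment> \<open>The linear terms differ in norm by \<open>2 * (1 - \<alpha>) * r\<close>,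
      which strictly exceeds the sum of the two remainders.\<close>
    hence "(2 - \<alpha>) * r - norm (?q + of_real (1 - \<alpha>) * f z) \<le> (\<Sum>n. x n * r ^ n)"
      "norm (?q - of_real (1 + \<alpha>) * f z) - \<alpha> * r \<le> (\<Sum>n. y n * r ^ n)"
      using X Y norm_triangle_ineq3[of "?q + of_real (1 - \<alpha>) * f z" "of_real (2 - \<alpha>) * z"]
        norm_triangle_ineq3[of "?q - of_real (1 + \<alpha>) * f z" "of_real (- \<alpha>) * z"] by linarith+
    with XY have "norm (?q - of_real (1 + \<alpha>) * f z) < norm (?q + of_real (1 - \<alpha>) * f z)"
      by (simp add: algebra_simps)
    from Re_divide_gt_of_norm_less[OF this] show ?thesis by blast
  qed
  thus ?thesis using HS_star_iff[OF d] by blast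
qed

section \<open>Wright coefficients\<close>

lemma wright_coeff_1: "0 < a \<Longrightarrow> 0 < c \<Longrightarrow> wright_coeff a b c d 1 = 1"
  by (simp add: wright_coeff_def)
     (metis Gamma_real_pos less_irrefl)

text \<open>From index 1 on the arguments of \<open>Gamma\<close> are positive; at index 0 they may
  be negative.\<close>

lemma wright_coeff_nonneg:
  assumes "0 < a" "0 < c" "0 \<le> b" "0 \<le> d" "n \<ge> 1"
  shows "0 \<le> wright_coeff a b c d n"
  unfolding wright_coeff_def using assms
  by (intro divide_nonneg_nonneg mult_nonneg_nonneg less_imp_le[OF Gamma_real_pos] add_pos_nonneg) auto

lemma wright_disc_series:
  assumes pos: "0 < a" "0 < c" "0 \<le> b" "0 \<le> d" and fin: "wright_finite a b c d"
  shows "disc_series (\<lambda>n. if n = 0 then 0 else of_real (wright_coeff a b c d n)) (wright a b c d)"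
proof (subst disc_series_iff_tail2; (intro ballI)?)
  fix z :: complex assume z: "z \<in> ball 0 1"
  \<comment> \<open>Absorbing \<open>z\<^sup>2\<close> into the coefficients turns the shifted
    series into a power series starting at exponent 0.\<close>
  have "summable (\<lambda>n. norm (complex_of_real (wright_coeff a b c d (n + 2)) * z\<^sup>2))"
    unfolding norm_mult
    using fin wright_coeff_nonneg[OF pos]
    by (intro summable_mult2) (simp add: wright_finite_def)
  from disc_series_of_summable[OF this z]
  show "(\<lambda>n. (if n + 2 = 0 then 0 else of_real (wright_coeff a b c d (n + 2))) * z ^ (n + 2))
      sums (wright a b c d z - z)"
    by (simp add: wright_def power_add mult_ac power2_eq_square summable_sums)
qed (use pos wright_coeff_1 in auto)

section \<open>The image under the Wright operator\<close>

text \<open>The weights of the image depend on \<open>\<sigma>\<close> only through its norm, which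
  gives the first conclusion for every \<open>\<sigma>\<close>; the second also needs the signs of
  the coefficients.\<close>

theorem theorem2:
  fixes \<alpha> \<alpha>1 \<beta>1 \<gamma>1 \<delta>1 \<alpha>2 \<beta>2 \<gamma>2 \<delta>2 :: real
    and \<sigma> :: complex
    and f h g :: "complex \<Rightarrow> complex"
  assumes "0 \<le> \<alpha>" and "\<alpha> < 1"
    and "\<beta>1 \<ge> 0" and "\<beta>2 \<ge> 0" and "\<delta>1 \<ge> 0" and "\<delta>2 \<ge> 0"
    and "\<alpha>1 > 0" and "\<alpha>2 > 0" and "\<gamma>1 > 0" and "\<gamma>2 > 0"
    and "norm \<sigma> < 1"
    and "harmonic_decomp f h g"
    and "f \<in> SRH \<alpha>"
    and "wright_finite \<alpha>1 \<beta>1 \<gamma>1 \<delta>1" and "wright_finite \<alpha>2 \<beta>2 \<gamma>2 \<delta>2"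
    and "wright \<alpha>1 \<beta>1 \<gamma>1 \<delta>1 (1::real) + norm \<sigma> * wright \<alpha>2 \<beta>2 \<gamma>2 \<delta>2 (1::real) \<le> 2"
  shows "wright_op \<alpha>1 \<beta>1 \<gamma>1 \<delta>1 \<alpha>2 \<beta>2 \<gamma>2 \<delta>2 \<sigma> h g \<in> HS_star \<alpha> \<and>
      (\<sigma> \<in> \<real>\<^sub>\<ge>\<^sub>0 \<longrightarrow> wright_op \<alpha>1 \<beta>1 \<gamma>1 \<delta>1 \<alpha>2 \<beta>2 \<gamma>2 \<delta>2 \<sigma> h g \<in> SRH \<alpha>)"
proof -
  note \<alpha> = assms(1,2)
  obtain a b where ab: "disc_series a h" "disc_series b g" "a 0 = 0" "a 1 = 1" "b 0 = 0"
    and b1: "norm (b 1) < 1" and a: "\<And>n. n \<ge> 2 \<Longrightarrow> a n = - of_real (norm (a n))"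
    and b: "\<And>n. b n = of_real (norm (b n))"
    using SRH_coeffs[OF assms(13,12)] by metis
  have cw: "coeff_weight \<alpha> a b n \<le> 1 - \<alpha>" for n
    using coeff_weight_le_of_HS_star[OF _ assms(12) ab a b \<alpha>] assms(13) by (auto simp: SRH_def)
  have cw_a: "(real n - \<alpha>) * norm (a n) \<le> 1 - \<alpha>" if "n \<ge> 2" for n
  proof -
    have "0 \<le> (real n + \<alpha>) * norm (b n)" using \<alpha> by simp
    thus ?thesis using cw[of n] that by (simp add: coeff_weight_def)
  qed
  have cw_b: "(real n + \<alpha>) * norm (b n) \<le> 1 - \<alpha>" for n
  proof -
    have "n \<ge> 2 \<Longrightarrow> 0 \<le> (real n - \<alpha>) * norm (a n)" using \<alpha> by simp
    thus ?thesis using cw[of n] by (cases "n < 2") (auto simp: coeff_weight_def)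
  qed
  \<comment> \<open>Crude bounds on the coefficients, by which the Wright series at 1 dominate the
    Hadamard products.\<close>
  have a_le: "norm (a n) \<le> 1" for n
  proof -
    have "1 * norm (a n) \<le> (real n - \<alpha>) * norm (a n)" if "n \<ge> 2"
      using \<alpha> that by (intro mult_right_mono) auto
    thus ?thesis using cw_a[of n] ab \<alpha> by (cases "n < 2") (auto simp: less_2_cases_iff)
  qed
  have b_le: "norm (b n) \<le> 1" for n
  proof -
    have "1 * norm (b n) \<le> (real n + \<alpha>) * norm (b n)" if "n \<ge> 1"
      using \<alpha> that by (intro mult_right_mono) auto
    thus ?thesis using cw_b[of n] ab \<alpha> by (cases "n = 0") auto
  qed

  define w where "w n = (if n = 0 then 0 else wright_coeff \<alpha>1 \<beta>1 \<gamma>1 \<delta>1 n)" for n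
  define v where "v n = (if n = 0 then 0 else wright_coeff \<alpha>2 \<beta>2 \<gamma>2 \<delta>2 n)" for n
  have w0: "w n \<ge> 0" and v0: "v n \<ge> 0" for n
    using wright_coeff_nonneg assms by (auto simp: w_def v_def)
  have w1: "w 0 = 0" "w 1 = 1" and v1: "v 0 = 0" "v 1 = 1"
    using wright_coeff_1 assms by (auto simp: w_def v_def)
  have wsm2: "summable (\<lambda>n. w (n + 2))" and vsm2: "summable (\<lambda>n. v (n + 2))"
    using assms by (auto simp: w_def v_def wright_finite_def)
  hence wsm: "summable w" and vsm: "summable v"
    using summable_iff_shift[of w 2] summable_iff_shift[of v 2] by simp_all
  have W: "disc_series (\<lambda>n. of_real (w n)) (wright \<alpha>1 \<beta>1 \<gamma>1 \<delta>1)"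
    and V: "disc_series (\<lambda>n. of_real (v n)) (wright \<alpha>2 \<beta>2 \<gamma>2 \<delta>2)"
    using wright_disc_series[of \<alpha>1 \<gamma>1 \<beta>1 \<delta>1] wright_disc_series[of \<alpha>2 \<gamma>2 \<beta>2 \<delta>2] assms
    by (simp_all add: w_def v_def if_distrib[of complex_of_real] cong: if_cong)
  \<comment> \<open>Index 1 is weighted for \<open>b\<close> but not for \<open>a\<close>, so only
    the first Wright sum loses its leading 1. This turns the bound 2 of the hypothesis into
    1.\<close>
  have W1: "(\<Sum>n. w (n + 2)) = wright \<alpha>1 \<beta>1 \<gamma>1 \<delta>1 (1::real) - 1"
    by (simp add: w_def wright_def)
  have V1: "suminf v = wright \<alpha>2 \<beta>2 \<gamma>2 \<delta>2 (1::real)"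
    using suminf_split_initial_segment[OF vsm, of 2] v1
    by (simp add: wright_def numeral_2_eq_2) (simp add: v_def)

  let ?H = "hadamard h (wright \<alpha>1 \<beta>1 \<gamma>1 \<delta>1)"
  let ?G = "\<lambda>z. \<sigma> * hadamard g (wright \<alpha>2 \<beta>2 \<gamma>2 \<delta>2) z"
  let ?L = "wright_op \<alpha>1 \<beta>1 \<gamma>1 \<delta>1 \<alpha>2 \<beta>2 \<gamma>2 \<delta>2 \<sigma> h g"
  define A where "A n = a n * of_real (w n)" for n
  define B where "B n = \<sigma> * (b n * of_real (v n))" for n
  have HA: "disc_series A ?H" unfolding A_def
  proof (rule hadamard_disc_series[OF ab(1) W])
    show "summable (\<lambda>n. norm (a n * of_real (w n)))"
      using a_le w0 by (intro summable_comparison_test'[OF wsm]) (simp add: norm_mult mult_left_le_one_le)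
  qed
  have "disc_series (\<lambda>n. b n * of_real (v n)) (hadamard g (wright \<alpha>2 \<beta>2 \<gamma>2 \<delta>2))"
  proof (rule hadamard_disc_series[OF ab(2) V])
    show "summable (\<lambda>n. norm (b n * of_real (v n)))"
      using b_le v0 by (intro summable_comparison_test'[OF vsm]) (simp add: norm_mult mult_left_le_one_le)
  qed
  hence GB: "disc_series B ?G"
    unfolding disc_series_def B_def mult.assoc by (intro ballI sums_mult) auto
  have AB: "A 0 = 0" "A 1 = 1" "B 0 = 0" using ab w1 by (auto simp: A_def B_def)
  have B1: "norm (B 1) < 1"
    using mult_left_le_one_le[of "norm (b 1)" "norm \<sigma>"] b1 assms(11) v1
    by (simp add: B_def norm_mult)
  have d: "harmonic_decomp ?L ?H ?G"
    by (rule harmonic_decompI[OF HA GB AB B1]) (simp add: wright_op_def)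

  \<comment> \<open>Majorant of the image weights: each old weight is at most
    \<open>1 - \<alpha>\<close> and is multiplied by \<open>w n\<close> or by
    \<open>norm \<sigma> * v n\<close>.\<close>
  let ?u = "\<lambda>n. (1 - \<alpha>) * ((if n < 2 then 0 else w n) + norm \<sigma> * v n)"
  have wsm': "summable (\<lambda>n. if n < 2 then 0 else w n)"
    using wsm2 summable_iff_shift[of "\<lambda>n. if n < 2 then 0 else w n" 2] by simp
  have cw': "coeff_weight \<alpha> A B n \<le> ?u n" for n
  proof -
    have "(real n - \<alpha>) * norm (A n) \<le> (1 - \<alpha>) * w n" if "n \<ge> 2"
      using mult_right_mono[OF cw_a[OF that] w0[of n]] w0[of n]
      by (simp add: A_def norm_mult mult.assoc)
    moreover have "(real n + \<alpha>) * norm (B n) \<le> (1 - \<alpha>) * (norm \<sigma> * v n)"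
      using mult_right_mono[OF cw_b[of n], of "norm \<sigma> * v n"] v0[of n]
      by (simp add: B_def norm_mult mult_ac)
    ultimately show ?thesis by (auto simp: coeff_weight_def distrib_left intro: add_mono)
  qed
  have usm: "summable ?u" using wsm' vsm by (intro summable_mult summable_add)
  have csm: "summable (coeff_weight \<alpha> A B)"
    using cw' coeff_weight_nonneg[OF \<alpha>] by (intro summable_comparison_test'[OF usm]) simp
  have "(\<Sum>n. coeff_weight \<alpha> A B n) \<le> suminf ?u"
    by (rule suminf_le[OF cw' csm usm])
  also have "suminf ?u = (1 - \<alpha>) * ((\<Sum>n. if n < 2 then 0 else w n) + norm \<sigma> * suminf v)"
    using wsm' vsm by (simp add: suminf_mult suminf_add[symmetric] summable_add summable_mult)
  also have "(\<Sum>n. if n < 2 then 0 else w n) = (\<Sum>n. w (n + 2))"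
    using suminf_split_initial_segment[OF wsm', of 2] by (simp add: numeral_2_eq_2)
  also have "(1 - \<alpha>) * ((\<Sum>n. w (n + 2)) + norm \<sigma> * suminf v) \<le> (1 - \<alpha>) * 1"
    unfolding W1 V1 using \<alpha> assms(16) by (intro mult_left_mono) auto
  finally have le: "(\<Sum>n. coeff_weight \<alpha> A B n) \<le> 1 - \<alpha>" by simp
  have "coeff_weight \<alpha> A B 1 \<le> (1 - \<alpha>) * norm \<sigma>" using cw'[of 1] v1 by simp
  also have "\<dots> < 1 - \<alpha>" using assms(11) \<alpha> by simp
  finally have c1: "coeff_weight \<alpha> A B 1 < 1 - \<alpha>" .
  have HS: "?L \<in> HS_star \<alpha>"
    by (rule HS_star_of_coeff_weight[OF d HA GB AB \<alpha> csm le c1])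
  moreover have "?L \<in> SRH \<alpha>" if \<sigma>: "\<sigma> \<in> \<real>\<^sub>\<ge>\<^sub>0"
  proof -
    \<comment> \<open>Multiplication by the nonnegative \<open>w n\<close>, \<open>v n\<close> and
      \<open>\<sigma>\<close> preserves the sign pattern.\<close>
    have An: "A n = - of_real (norm (A n))" if "n \<ge> 2" for n
    proof -
      have "A n = - of_real (norm (a n) * w n)" 
        using arg_cong[OF a[OF that], of "\<lambda>x. x * of_real (w n)"] by (simp add: A_def)
      thus ?thesis using w0[of n] by (simp add: norm_mult)
    qed
    have Bn: "B n = of_real (norm (B n))" for n
    proof -
      obtain s where s: "\<sigma> = of_real s" "s \<ge> 0" using \<sigma> by (auto elim: nonneg_Reals_cases)
      have "B n = of_real (s * (norm (b n) * v n))"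
        using arg_cong[OF b[of n], of "\<lambda>x. of_real s * (x * of_real (v n))"] s
        by (simp add: B_def)
      thus ?thesis using v0[of n] s by (simp add: norm_mult)
    qed
    have "(\<lambda>n. of_real (norm (A (n + 2))) * z ^ (n + 2)) sums (z - ?H z)" if "z \<in> ball 0 1" for z
    proof -
      have "(\<lambda>n. A (n + 2) * z ^ (n + 2)) sums (?H z - z)"
        using disc_series_iff_tail2[of A ?H] AB HA that by blast
      from sums_minus[OF this] have "(\<lambda>n. - A (n + 2) * z ^ (n + 2)) sums (z - ?H z)" by simp
      moreover have "- A (n + 2) = of_real (norm (A (n + 2)))" for n
        using arg_cong[OF An[of "n + 2"], of uminus] by simp
      ultimately show ?thesis by (simp only:)
    qed
    moreover have "(\<lambda>n. of_real (norm (B (n + 1))) * z ^ (n + 1)) sums ?G z" if "z \<in> ball 0 1" for z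
    proof -
      have "(\<lambda>n. B (n + 1) * z ^ (n + 1)) sums ?G z"
        using disc_series_iff_tail1[of B ?G] AB(3) GB that by blast
      thus ?thesis by (simp only: Bn[symmetric])
    qed
    ultimately show ?thesis using HS d B1 unfolding SRH_def by blast
  qed
  ultimately show ?thesis by blast
qed

end
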